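(* Let $R:\mathbb{R}^n\to\mathbb{Z}^n$ be a quantizer, $L\in\mathbb{R}^{n\times n}$ a nonsingular matrix, and $T=R\circ L:\mathbb{Z}^n\to\mathbb{Z}^n$ the transition operator of the quantized linear $(R,L)$-system. The associated, backward and forward algebras $\mathcal{Q}$, $\mathcal{Q}^-$, $\mathcal{Q}^+$ are transformed by $T$ and its set-valued inverse $T^{-1}$ as follows: (a) the associated algebra is invariant under $T$ and $T^{-1}$: $T^{-1}(\mathcal{Q})\subset\mathcal{Q}$ and $T(\mathcal{Q})\subset\mathcal{Q}$; (b) the forward algebra is invariant under $T^{-1}$: $T^{-1}(\mathcal{Q}^+)\subset\mathcal{Q}^+$; (c) the backward algebra is invariant under $T$: $T(\mathcal{Q}^-)\subset\mathcal{Q}^-$; (d) for any $A\in\mathcal{Q}$ there exists $N\in\mathbb{N}$ such that $T^{-k}(A)\in\mathcal{Q}^+$ and $T^k(A)\in\mathcal{Q}^-$ for all $k\ge N$.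
   Context: A quantizer is a map $R:\mathbb{R}^n\to\mathbb{Z}^n$ such that $R(u+z)=R(u)+z$ for all $u\in\mathbb{R}^n$, $z\in\mathbb{Z}^n$, and the set $R^{-1}(0)=\{u\in\mathbb{R}^n: R(u)=0\}$ is Jordan measurable (bounded with boundary of zero Lebesgue measure). For $A\subset\mathbb{Z}^n$, $T(A)$ and $T^{-1}(A)$ denote the image and the preimage of $A$ under $T:\mathbb{Z}^n\to\mathbb{Z}^n$ ($T^k$, $T^{-k}$ similarly for the $k$-th iterate), and for a class $\mathcal{C}$ of subsets, $T(\mathcal{C})=\{T(A): A\in\mathcal{C}\}$, $T^{-1}(\mathcal{C})=\{T^{-1}(A): A\in\mathcal{C}\}$. For $m\in\mathbb{N}$, $G\subset\mathbb{R}^m$ and $\Lambda\in\mathbb{R}^{m\times n}$ let $Q_m(G,\Lambda)=\{x\in\mathbb{Z}^n:\ \Lambda x\in G+\mathbb{Z}^m\}$ and $\mathcal{Q}_m(\Lambda)=\{Q_m(G,\Lambda):\ G\subset[0,1)^m\text{ Jordan measurable}\}$. For a matrix $\mathcal{M}$ with $n$ columns and countably infinitely many rows, $\mathcal{Q}_\infty(\mathcal{M})$ is the union of $\mathcal{Q}_m(\Lambda)$ over all $m\in\mathbb{N}$ and all $m\times n$ submatrices $\Lambda$ of $\mathcal{M}$ (formed from $m$ rows with distinct indices). Let $\mathcal{L}^-$ be the infinite matrix obtained by stacking the powers $\ldots,L^{-2},L^{-1}$, $\mathcal{L}^+$ the infinite matrix obtained by stacking $L,L^2,\ldots$, and $\mathcal{L}=\begin{bmatrix}\mathcal{L}^-\\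 \mathcal{L}^+\end{bmatrix}$. The associated algebra is $\mathcal{Q}=\mathcal{Q}_\infty(\mathcal{L})$, the backward algebra is $\mathcal{Q}^-=\mathcal{Q}_\infty(\mathcal{L}^-)$ and the forward algebra is $\mathcal{Q}^+=\mathcal{Q}_\infty(\mathcal{L}^+)$. *)

theory Defs
  imports "HOL-Analysis.Analysis"
begin

text \<open>
  Lattice points are represented by the type \<open>int ^ 'n\<close>, embedded into \<open>real ^ 'n\<close>.
\<close>

definition vec_of_int :: "int ^ 'n \<Rightarrow> real ^ 'n" where
  "vec_of_int z = (\<chi> i. of_int (z $ i))"

definition jordan_measurable :: "'a :: euclidean_space set \<Rightarrow> bool" where
  "jordan_measurable S \<longleftrightarrow> bounded S \<and> frontier S \<in> null_sets lebesgue"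

definition quantizer :: "(real ^ 'n \<Rightarrow> int ^ 'n) \<Rightarrow> bool" where
  "quantizer R \<longleftrightarrow>
     (\<forall>u z. R (u + vec_of_int z) = R u + z) \<and> jordan_measurable {u. R u = 0}"

definition transition :: "(real ^ 'n \<Rightarrow> int ^ 'n) \<Rightarrow> real ^ 'n ^ 'n \<Rightarrow> int ^ 'n \<Rightarrow> int ^ 'n" where
  "transition R L x = R (L *v vec_of_int x)"

text \<open>
  The dimension \<open>m\<close> of the codomain of the matrices \<open>\<Lambda>\<close> ranges over all positive integers
  inside the definition of the algebras, so it cannot be a type. The space of real \<open>m\<close>-vectors is
  therefore modelled by the extensional functions \<open>{..<m} \<rightarrow>\<^sub>E UNIV\<close> with the product topology;
  the completed product of \<open>lborel\<close> is the Lebesgue measure on it.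
\<close>

definition jordan_measurable_fn :: "nat \<Rightarrow> (nat \<Rightarrow> real) set \<Rightarrow> bool" where
  "jordan_measurable_fn m G \<longleftrightarrow>
     G \<subseteq> {..<m} \<rightarrow>\<^sub>E UNIV \<and>
     (\<exists>B. \<forall>g\<in>G. \<forall>i<m. \<bar>g i\<bar> \<le> B) \<and>
     product_topology (\<lambda>_. euclideanreal) {..<m} frontier_of G
       \<in> null_sets (completion (Pi\<^sub>M {..<m} (\<lambda>_. lborel)))"

text \<open>
  An \<open>m \<times> n\<close> matrix is given by its rows \<open>\<Lambda> 0, \<dots>, \<Lambda> (m - 1)\<close>; the other values of \<open>\<Lambda>\<close> are
  irrelevant.
\<close>

definition quasi_set :: "nat \<Rightarrow> (nat \<Rightarrow> real) set \<Rightarrow> (nat \<Rightarrow> real ^ 'n) \<Rightarrow> (int ^ 'n) set" where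
  "quasi_set m G \<Lambda> =
     {x. \<exists>g\<in>G. \<exists>z :: nat \<Rightarrow> int. \<forall>i<m. \<Lambda> i \<bullet> vec_of_int x = g i + of_int (z i)}"

definition quasi_class :: "nat \<Rightarrow> (nat \<Rightarrow> real ^ 'n) \<Rightarrow> (int ^ 'n) set set" where
  "quasi_class m \<Lambda> =
     {quasi_set m G \<Lambda> | G. G \<subseteq> {..<m} \<rightarrow>\<^sub>E {0..<1} \<and> jordan_measurable_fn m G}"

text \<open>
  A matrix with infinitely many rows is a family \<open>M\<close> of rows over an index set \<open>J\<close>; the
  injection \<open>r\<close> selects the rows of an \<open>m \<times> n\<close> submatrix.
\<close>

definition quasi_algebra :: "'r set \<Rightarrow> ('r \<Rightarrow> real ^ 'n) \<Rightarrow> (int ^ 'n) set set" where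
  "quasi_algebra J M =
     (\<Union>m\<in>{1..}. \<Union>r\<in>{r. inj_on r {..<m} \<and> r ` {..<m} \<subseteq> J}. quasi_class m (\<lambda>i. M (r i)))"

text \<open>
  The operation \<open>^\<close> on square matrices would be the componentwise power.
\<close>

definition matrix_powi :: "real ^ 'n ^ 'n \<Rightarrow> int \<Rightarrow> real ^ 'n ^ 'n" where
  "matrix_powi L k =
     (if k \<ge> 0 then (((**) L) ^^ nat k) (mat 1)
      else (((**) (matrix_inv L)) ^^ nat (- k)) (mat 1))"

text \<open>
  Row \<open>(k, i)\<close> of the stacked powers of \<open>L\<close> is the \<open>i\<close>-th row of the \<open>k\<close>-th power. The exponent
  \<open>0\<close> occurs in none of the three stacks.
\<close>

definition stacked_powers :: "real ^ 'n ^ 'n \<Rightarrow> int \<times> 'n \<Rightarrow> real ^ 'n" where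
  "stacked_powers L = (\<lambda>(k, i). row i (matrix_powi L k))"

definition associated_algebra :: "real ^ 'n ^ 'n \<Rightarrow> (int ^ 'n) set set" where
  "associated_algebra L = quasi_algebra ({k. k \<noteq> 0} \<times> UNIV) (stacked_powers L)"

definition backward_algebra :: "real ^ 'n ^ 'n \<Rightarrow> (int ^ 'n) set set" where
  "backward_algebra L = quasi_algebra ({k. k < 0} \<times> UNIV) (stacked_powers L)"

definition forward_algebra :: "real ^ 'n ^ 'n \<Rightarrow> (int ^ 'n) set set" where
  "forward_algebra L = quasi_algebra ({k. k > 0} \<times> UNIV) (stacked_powers L)"

end

theory Submission
  imports Defs
begin

text \<open>
  Let \<open>V = R\<^sup>-\<^sup>1(0)\<close>. Then \<open>T x = y\<close> means \<open>L x - y \<in> V\<close>, equivalently \<open>L\<^sup>-\<^sup>1 y - x \<in> W\<close> with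
  \<open>W = -L\<^sup>-\<^sup>1 V\<close>. So \<open>T\<^sup>-\<^sup>1(A)\<close> and \<open>T(A)\<close> are both of the form
  \<open>{x. \<exists>y\<in>A. B x - y \<in> W}\<close> with \<open>B = L\<close> and \<open>B = L\<^sup>-\<^sup>1\<close> respectively, and replacing \<open>L\<close> by
  \<open>L\<^sup>-\<^sup>1\<close> swaps the forward and backward algebras.

  If \<open>A\<close> is given by the rows \<open>\<Lambda>\<close>, write \<open>B x = h + w\<close> and \<open>y = w + s\<close> with \<open>h \<in> [0,1)\<^sup>n\<close> and
  \<open>w, s\<close> integer. Then \<open>\<Lambda> y = \<Lambda>B x - \<Lambda>(h - s)\<close> and \<open>B x - y = h - s\<close>, so membership of \<open>x\<close> is
  decided by \<open>\<Lambda>B x\<close> and \<open>B x\<close> modulo 1: every exponent rises by one, and the exponent 1 is added.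
  Only finitely many \<open>s\<close> matter, and Jordan measurability survives since the frontier of a preimage
  lies in the preimage of the frontier, and affine surjections pull null sets back to null sets.
\<close>

section \<open>Null sets under affine surjections\<close>

text \<open>
  A section \<open>\<tau>\<close> makes the measure of \<open>{x. \<phi> x + y \<in> N}\<close> independent of \<open>y\<close>, while by Tonelli its
  integral over \<open>y\<close> vanishes. So a linear surjection pulls null sets back to null sets.
\<close>

lemma null_sets_vimage_if_translation_invariant:
  assumes "sigma_finite_measure X" "sigma_finite_measure Y"
    and \<phi> [measurable]: "\<phi> \<in> measurable X Y"
    and add [measurable]: "(\<lambda>(u, y). add u y) \<in> measurable (Y \<Otimes>\<^sub>M Y) Y"
    and \<tau> [measurable]: "\<And>y. y \<in> space Y \<Longrightarrow> \<tau> y \<in> measurable X X"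
    and X_inv: "\<And>y. y \<in> space Y \<Longrightarrow> distr X X (\<tau> y) = X"
    and eq: "\<And>x y. x \<in> space X \<Longrightarrow> y \<in> space Y \<Longrightarrow> \<phi> (\<tau> y x) = add (\<phi> x) y"
    and Y_inv: "\<And>u. u \<in> space Y \<Longrightarrow> distr Y Y (add u) = Y"
    and nonzero: "emeasure Y (space Y) \<noteq> 0"
    and N: "N \<in> null_sets Y"
  shows "\<phi> -` N \<inter> space X \<in> null_sets X"
proof -
  interpret pair_sigma_finite X Y
    using assms(1,2) by (rule pair_sigma_finite.intro)
  have [measurable]: "N \<in> sets Y" using N by auto
  define f where "f = (\<lambda>(x, y). indicator N (add (\<phi> x) y) :: ennreal)"
  have f_eq: "f = (\<lambda>p. indicator N ((\<lambda>(u, y). add u y) (\<phi> (fst p), snd p)))"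
    by (auto simp: f_def)
  have [measurable]: "f \<in> borel_measurable (X \<Otimes>\<^sub>M Y)"
    unfolding f_eq by measurable
  define c where "c = emeasure X (\<phi> -` N \<inter> space X)"
  have X_int: "(\<integral>\<^sup>+ x. f (x, y) \<partial>X) = c" if y: "y \<in> space Y" for y
  proof -
    have "(\<integral>\<^sup>+ x. f (x, y) \<partial>X) = (\<integral>\<^sup>+ x. indicator N (\<phi> (\<tau> y x)) \<partial>X)"
      by (intro nn_integral_cong) (simp add: f_def eq y)
    also have "\<dots> = (\<integral>\<^sup>+ x. indicator N (\<phi> x) \<partial>distr X X (\<tau> y))"
      using y by (subst nn_integral_distr) auto
    also have "\<dots> = (\<integral>\<^sup>+ x. indicator (\<phi> -` N \<inter> space X) x \<partial>X)"
      unfolding X_inv[OF y] by (intro nn_integral_cong) (auto simp: indicator_def)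
    also have "\<dots> = c" by (simp add: c_def)
    finally show ?thesis .
  qed
  have Y_int: "(\<integral>\<^sup>+ y. f (x, y) \<partial>Y) = 0" if x: "x \<in> space X" for x
  proof -
    have u: "\<phi> x \<in> space Y" using measurable_space[OF \<phi> x] .
    have [measurable]: "add (\<phi> x) \<in> measurable Y Y"
      using measurable_Pair2[OF add u] by simp
    have "(\<integral>\<^sup>+ y. f (x, y) \<partial>Y) = (\<integral>\<^sup>+ y. indicator N y \<partial>distr Y Y (add (\<phi> x)))"
      by (subst nn_integral_distr) (auto simp: f_def)
    also have "\<dots> = 0" using N by (simp add: Y_inv[OF u] null_setsD1)
    finally show ?thesis .
  qed
  have "c * emeasure Y (space Y) = (\<integral>\<^sup>+ y. (\<integral>\<^sup>+ x. f (x, y) \<partial>X) \<partial>Y)"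
    by (simp add: X_int cong: nn_integral_cong)
  also have "\<dots> = (\<integral>\<^sup>+ x. (\<integral>\<^sup>+ y. f (x, y) \<partial>Y) \<partial>X)"
    by (rule Fubini) simp
  also have "\<dots> = 0"
    by (simp add: Y_int cong: nn_integral_cong)
  \<comment> \<open>The total mass of \<open>Y\<close> may be infinite; a vanishing product of
    extended nonnegative reals still forces \<open>c = 0\<close>.\<close>
  finally have "c = 0" using nonzero by simp
  then show ?thesis unfolding c_def by auto
qed

section \<open>Lebesgue measure on finite products of the real line\<close>

abbreviation lborel_fn :: "'i set \<Rightarrow> ('i \<Rightarrow> real) measure" where
  "lborel_fn I \<equiv> Pi\<^sub>M I (\<lambda>_. lborel)"

abbreviation euclidean_fn :: "'i set \<Rightarrow> ('i \<Rightarrow> real) topology" where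
  "euclidean_fn I \<equiv> product_topology (\<lambda>_. euclideanreal) I"

lemma emeasure_lborel_fn:
  assumes "finite I" "\<And>i. i \<in> I \<Longrightarrow> A i \<in> sets borel"
  shows "emeasure (lborel_fn I) (Pi\<^sub>E I A) = (\<Prod>i\<in>I. emeasure lborel (A i))"
proof -
  interpret product_sigma_finite "\<lambda>_::'a. lborel :: real measure" by standard
  show ?thesis using assms by (subst emeasure_PiM) auto
qed

lemma sigma_finite_lborel_fn: "finite I \<Longrightarrow> sigma_finite_measure (lborel_fn I)"
proof -
  interpret product_sigma_finite "\<lambda>_::'a. lborel :: real measure" by standard
  show "finite I \<Longrightarrow> sigma_finite_measure (lborel_fn I)" by (rule sigma_finite)
qed

text \<open>The product measure is determined by its values on boxes, and there the claim splits
  into translation invariance of each coordinate.\<close>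

lemma distr_lborel_fn_translate:
  fixes a :: "'i \<Rightarrow> real"
  assumes "finite I"
  shows "distr (lborel_fn I) (lborel_fn I) (\<lambda>x. \<lambda>i\<in>I. x i + a i) = lborel_fn I"
proof -
  interpret product_sigma_finite "\<lambda>_::'i. lborel :: real measure" by standard
  have "distr (lborel_fn I) (lborel_fn I) (\<lambda>x. \<lambda>i\<in>I. a i + x i) = lborel_fn I"
  proof (rule PiM_eqI)
    fix A :: "'i \<Rightarrow> real set"
    assume A: "\<And>i. i \<in> I \<Longrightarrow> A i \<in> sets lborel"
    have [measurable]: "Pi\<^sub>E I A \<in> sets (lborel_fn I)"
      using A assms by (intro sets_PiM_I_finite) auto
    have pre: "(+) (a i) -` A i \<in> sets borel" if "i \<in> I" for i
      using measurable_sets[of "(+) (a i)" borel borel "A i"] A[OF that] by simp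
    have "emeasure (distr (lborel_fn I) (lborel_fn I) (\<lambda>x. \<lambda>i\<in>I. a i + x i)) (Pi\<^sub>E I A) =
        emeasure (lborel_fn I) ((\<lambda>x. \<lambda>i\<in>I. a i + x i) -` Pi\<^sub>E I A \<inter> space (lborel_fn I))"
      by (subst emeasure_distr) auto
    also have "(\<lambda>x. \<lambda>i\<in>I. a i + x i) -` Pi\<^sub>E I A \<inter> space (lborel_fn I)
        = (\<Pi>\<^sub>E i\<in>I. (+) (a i) -` A i)"
      by (auto simp: space_PiM PiE_iff restrict_def extensional_def)
    also have "emeasure (lborel_fn I) \<dots> = (\<Prod>i\<in>I. emeasure lborel ((+) (a i) -` A i))"
      by (rule emeasure_lborel_fn[OF assms pre])
    also have "\<dots> = (\<Prod>i\<in>I. emeasure lborel (A i))"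
    proof (rule prod.cong)
      fix i assume "i \<in> I"
      then have "A i \<in> sets borel" using A by simp
      then have "emeasure lborel (A i) = emeasure (distr lborel borel ((+) (a i))) (A i)"
        by (simp only: lborel_distr_plus)
      also have "\<dots> = emeasure lborel ((+) (a i) -` A i)"
        using \<open>A i \<in> sets borel\<close> by (subst emeasure_distr) auto
      finally show "emeasure lborel ((+) (a i) -` A i) = emeasure lborel (A i)" by simp
    qed simp
    finally show "emeasure (distr (lborel_fn I) (lborel_fn I) (\<lambda>x. \<lambda>i\<in>I. a i + x i)) (Pi\<^sub>E I A) =
        (\<Prod>i\<in>I. emeasure lborel (A i))" .
  qed (use assms in auto)
  then show ?thesis by (simp add: add.commute)
qed

text \<open>For an affine \<open>\<phi>\<close>, \<open>\<sigma>\<close> is a right inverse of the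
  linear part: shifting the argument by \<open>\<sigma> y\<close> shifts the value by
  \<open>y\<close>. A null set of the completion is first covered by a Borel null set, to which the
  translation argument applies.\<close>

lemma null_sets_vimage_lborel_fn:
  fixes \<phi> :: "('i \<Rightarrow> real) \<Rightarrow> ('j \<Rightarrow> real)"
  assumes "finite I" "finite J"
    and "\<phi> \<in> measurable (lborel_fn I) (lborel_fn J)"
    and "\<And>x y j. j \<in> J \<Longrightarrow> \<phi> (\<lambda>i\<in>I. x i + \<sigma> y i) j = \<phi> x j + y j"
    and "N \<in> null_sets (completion (lborel_fn J))"
  shows "\<phi> -` N \<inter> (I \<rightarrow>\<^sub>E UNIV) \<in> null_sets (completion (lborel_fn I))"
proof -
  obtain N' where N': "N' \<in> null_sets (lborel_fn J)" "N \<subseteq> N'"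
    using assms(5) unfolding null_sets_completion_iff2 by (elim bexE)
  have ext: "\<phi> x \<in> J \<rightarrow>\<^sub>E UNIV" if "x \<in> I \<rightarrow>\<^sub>E UNIV" for x
    using measurable_space[OF assms(3), of x] that by (simp add: space_PiM)
  have "\<phi> -` N' \<inter> space (lborel_fn I) \<in> null_sets (lborel_fn I)"
  proof (rule null_sets_vimage_if_translation_invariant[where
        \<tau> = "\<lambda>y x. \<lambda>i\<in>I. x i + \<sigma> y i" and add = "\<lambda>u y. \<lambda>j\<in>J. y j + u j"])
    show "\<phi> (\<lambda>i\<in>I. x i + \<sigma> y i) = (\<lambda>j\<in>J. y j + \<phi> x j)"
      if "x \<in> space (lborel_fn I)" "y \<in> space (lborel_fn J)" for x y
    proof (rule extensionalityI[of _ J])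
      have "(\<lambda>i\<in>I. x i + \<sigma> y i) \<in> I \<rightarrow>\<^sub>E UNIV" by simp
      from ext[OF this] show "\<phi> (\<lambda>i\<in>I. x i + \<sigma> y i) \<in> extensional J"
        by (simp add: PiE_iff)
    qed (simp_all add: assms(4) add.commute)
    have "emeasure (lborel_fn J) (\<Pi>\<^sub>E j\<in>J. UNIV) \<noteq> 0"
      using assms(2) by (subst emeasure_lborel_fn) auto
    then show "emeasure (lborel_fn J) (space (lborel_fn J)) \<noteq> 0"
      by (simp add: space_PiM)
    show "(\<lambda>(u, y). \<lambda>j\<in>J. y j + u j) \<in> lborel_fn J \<Otimes>\<^sub>M lborel_fn J \<rightarrow>\<^sub>M lborel_fn J"
      unfolding case_prod_beta by measurable
    show "(\<lambda>x. \<lambda>i\<in>I. x i + \<sigma> y i) \<in> lborel_fn I \<rightarrow>\<^sub>M lborel_fn I" for y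
      by measurable
  qed (rule sigma_finite_lborel_fn distr_lborel_fn_translate assms(1-3) N'(1))+
  moreover have "\<phi> -` N \<inter> (I \<rightarrow>\<^sub>E UNIV) \<subseteq> \<phi> -` N' \<inter> space (lborel_fn I)"
    using N'(2) by (auto simp: space_PiM)
  ultimately show ?thesis
    unfolding null_sets_completion_iff2 by (rule bexI[rotated])
qed

text \<open>The counterpart for Euclidean codomains serves single real coordinates as well as the
  vector-valued map \<open>head\<close>.\<close>

lemma null_sets_vimage_lborel:
  fixes \<phi> :: "('i \<Rightarrow> real) \<Rightarrow> 'a :: euclidean_space"
  assumes "finite I"
    and "\<phi> \<in> borel_measurable (lborel_fn I)"
    and "\<And>x y. \<phi> (\<lambda>i\<in>I. x i + \<sigma> y i) = \<phi> x + y"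
    and "N \<in> null_sets lebesgue"
  shows "\<phi> -` N \<inter> (I \<rightarrow>\<^sub>E UNIV) \<in> null_sets (completion (lborel_fn I))"
proof -
  obtain N' where N': "N' \<in> null_sets lborel" "N \<subseteq> N'"
    using assms(4) unfolding null_sets_completion_iff2 by (elim bexE)
  have plus: "distr lborel lborel ((+) u) = lborel" for u :: 'a
    using lborel_distr_plus[of u] by (metis distr_cong sets_lborel)
  have "\<phi> -` N' \<inter> space (lborel_fn I) \<in> null_sets (lborel_fn I)"
  proof (rule null_sets_vimage_if_translation_invariant[where Y = lborel and
        \<tau> = "\<lambda>y x. \<lambda>i\<in>I. x i + \<sigma> y i" and add = "(+)"])
    show "\<phi> \<in> lborel_fn I \<rightarrow>\<^sub>M lborel"
      using assms(2) by simp
    show "(\<lambda>(u, y). u + y :: 'a) \<in> lborel \<Otimes>\<^sub>M lborel \<rightarrow>\<^sub>M lborel"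
      unfolding case_prod_beta by measurable
    show "(\<lambda>x. \<lambda>i\<in>I. x i + \<sigma> y i) \<in> lborel_fn I \<rightarrow>\<^sub>M lborel_fn I" for y
      by measurable
  qed (use lborel.sigma_finite_measure_axioms in \<open>simp_all add: assms N'(1)
      plus sigma_finite_lborel_fn distr_lborel_fn_translate del: restrict_apply\<close>)
  moreover have "\<phi> -` N \<inter> (I \<rightarrow>\<^sub>E UNIV) \<subseteq> \<phi> -` N' \<inter> space (lborel_fn I)"
    using N'(2) by (auto simp: space_PiM)
  ultimately show ?thesis
    unfolding null_sets_completion_iff2 by (rule bexI[rotated])
qed

section \<open>Jordan measurability of pulled back sets\<close>

text \<open>This is Jordan measurability without boundedness, so that complements and preimages
  under projections stay in the class.\<close>

definition null_frontier :: "'i set \<Rightarrow> ('i \<Rightarrow> real) set \<Rightarrow> bool" where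
  "null_frontier I S \<longleftrightarrow> euclidean_fn I frontier_of S \<in> null_sets (completion (lborel_fn I))"

lemma null_frontier_Int:
  assumes "null_frontier I S" "null_frontier I T"
  shows "null_frontier I (S \<inter> T)"
  using null_sets_completion_subset[OF frontier_of_Int_subset] assms
  unfolding null_frontier_def by (metis null_sets.Un)

lemma null_frontier_UN:
  assumes "finite K" "\<And>k. k \<in> K \<Longrightarrow> null_frontier I (S k)"
  shows "null_frontier I (\<Union>k\<in>K. S k)"
proof -
  have "(\<Union>k\<in>K. euclidean_fn I frontier_of S k) \<in> null_sets (completion (lborel_fn I))"
    using assms unfolding null_frontier_def by (intro null_sets.finite_UN) auto
  moreover have "euclidean_fn I frontier_of (\<Union>k\<in>K. S k) \<subseteq> (\<Union>k\<in>K. euclidean_fn I frontier_of S k)"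
    using frontier_of_Union_subset[of "S ` K" "euclidean_fn I"] assms(1) by auto
  ultimately show ?thesis
    unfolding null_frontier_def by (rule null_sets_completion_subset[rotated])
qed

lemma null_frontier_Compl:
  assumes "null_frontier I S"
  shows "null_frontier I ((I \<rightarrow>\<^sub>E UNIV) - S)"
  using assms frontier_of_complement[of "euclidean_fn I" S] by (simp add: null_frontier_def)

lemma null_frontier_vimage_fn:
  fixes \<phi> :: "('i \<Rightarrow> real) \<Rightarrow> ('j \<Rightarrow> real)"
  assumes "finite I" "finite J"
    and "\<phi> \<in> measurable (lborel_fn I) (lborel_fn J)"
    and "continuous_map (euclidean_fn I) (euclidean_fn J) \<phi>"
    and "\<And>x y j. j \<in> J \<Longrightarrow> \<phi> (\<lambda>i\<in>I. x i + \<sigma> y i) j = \<phi> x j + y j"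
    and "null_frontier J S"
  shows "null_frontier I {x \<in> I \<rightarrow>\<^sub>E UNIV. \<phi> x \<in> S}"
proof -
  have "euclidean_fn I frontier_of {x \<in> I \<rightarrow>\<^sub>E UNIV. \<phi> x \<in> S}
      \<subseteq> \<phi> -` (euclidean_fn J frontier_of S) \<inter> (I \<rightarrow>\<^sub>E UNIV)"
    using continuous_map_frontier_frontier_preimage_subset[OF assms(4), of S] by auto
  moreover have "\<phi> -` (euclidean_fn J frontier_of S) \<inter> (I \<rightarrow>\<^sub>E UNIV)
      \<in> null_sets (completion (lborel_fn I))"
    by (rule null_sets_vimage_lborel_fn[OF assms(1-3)])
      (use assms(5,6) in \<open>simp_all only: null_frontier_def\<close>)
  ultimately show ?thesis
    unfolding null_frontier_def by (rule null_sets_completion_subset)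
qed

lemma null_frontier_vimage:
  fixes \<phi> :: "('i \<Rightarrow> real) \<Rightarrow> 'a :: euclidean_space"
  assumes "finite I"
    and "\<phi> \<in> borel_measurable (lborel_fn I)"
    and "continuous_map (euclidean_fn I) euclidean \<phi>"
    and "\<And>x y. \<phi> (\<lambda>i\<in>I. x i + \<sigma> y i) = \<phi> x + y"
    and "frontier S \<in> null_sets lebesgue"
  shows "null_frontier I {x \<in> I \<rightarrow>\<^sub>E UNIV. \<phi> x \<in> S}"
proof -
  have "euclidean_fn I frontier_of {x \<in> I \<rightarrow>\<^sub>E UNIV. \<phi> x \<in> S}
      \<subseteq> \<phi> -` frontier S \<inter> (I \<rightarrow>\<^sub>E UNIV)"
    using continuous_map_frontier_frontier_preimage_subset[OF assms(3), of S] by auto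
  moreover have "\<phi> -` frontier S \<inter> (I \<rightarrow>\<^sub>E UNIV) \<in> null_sets (completion (lborel_fn I))"
    by (rule null_sets_vimage_lborel[OF assms(1,2,4,5)])
  ultimately show ?thesis
    unfolding null_frontier_def by (rule null_sets_completion_subset)
qed

lemma continuous_map_fn_coordinate:
  "i \<in> I \<Longrightarrow> continuous_map (euclidean_fn I) euclideanreal (\<lambda>x. x i)"
  by (rule continuous_map_product_projection)

text \<open>The cube is the complement of a finite union of preimages of \<open>- {0..<1}\<close>
  under the coordinate projections, and an interval has a finite frontier. Passing to complements
  also covers empty \<open>I\<close>.\<close>

lemma null_frontier_unit_cube:
  assumes "finite I"
  shows "null_frontier I (I \<rightarrow>\<^sub>E {0..<1})"
proof -
  have "null_frontier I {x \<in> I \<rightarrow>\<^sub>E UNIV. x i \<in> - {0..<1}}" if i: "i \<in> I" for i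
  proof (rule null_frontier_vimage[OF assms _ continuous_map_fn_coordinate[OF i]])
    show "(\<lambda>x. x i) \<in> borel_measurable (lborel_fn I)"
      using i by measurable
    show "(\<lambda>k\<in>I. x k + (if k = i then y else 0)) i = x i + y" for x :: "'a \<Rightarrow> real" and y
      using i by simp
    have "finite (frontier {0..<1::real})"
      by (simp add: frontier_def)
    then show "frontier (- {0..<1::real}) \<in> null_sets lebesgue"
      by (simp add: finite_imp_null_set_lborel null_sets_completionI frontier_complement)
  qed
  then have "null_frontier I ((I \<rightarrow>\<^sub>E UNIV) - (\<Union>i\<in>I. {x \<in> I \<rightarrow>\<^sub>E UNIV. x i \<in> - {0..<1}}))"
    using assms by (intro null_frontier_Compl null_frontier_UN)
  also have "(I \<rightarrow>\<^sub>E UNIV) - (\<Union>i\<in>I. {x \<in> I \<rightarrow>\<^sub>E UNIV. x i \<in> - {0..<1}}) = I \<rightarrow>\<^sub>E {0..<1::real}"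
    by (auto simp: PiE_iff)
  finally show ?thesis .
qed

section \<open>The pullback on the torus and its Jordan measurability\<close>

lemma finite_bounded_int_vec:
  fixes C :: int
  shows "finite {s :: int ^ 'n. \<forall>i. \<bar>s $ i\<bar> \<le> C}"
proof -
  have "finite ((UNIV :: 'n set) \<rightarrow>\<^sub>E {- C..C})"
    by (intro finite_PiE) auto
  moreover have "{s :: int ^ 'n. \<forall>i. \<bar>s $ i\<bar> \<le> C} \<subseteq> vec_lambda ` (UNIV \<rightarrow>\<^sub>E {- C..C})"
    by (auto intro!: image_eqI[of s vec_lambda "vec_nth s" for s] simp: abs_le_iff minus_le_iff)
  ultimately show ?thesis by (meson finite_imageI finite_subset)
qed

text \<open>
  \<open>Z\<close> collects the rows of \<open>\<Lambda>\<close> that the multiplication by \<open>B\<close> turns into rows of the identity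
  matrix. These are integer on lattice points, so they get no coordinate in the new torus, and
  their linear independence is needed instead.
\<close>

locale torus_pullback =
  fixes I :: "'i set" and J Z :: "'j set" and p :: "'j \<Rightarrow> 'i" and q :: "'n :: finite \<Rightarrow> 'i"
    and \<Lambda> :: "'j \<Rightarrow> real ^ 'n"
  assumes finite_I: "finite I" and finite_J: "finite J" and Z: "Z \<subseteq> J"
    and p_in: "j \<in> J - Z \<Longrightarrow> p j \<in> I" and inj_p: "inj_on p (J - Z)"
    and q_in: "q i \<in> I" and inj_q: "inj q"
    and disjoint: "j \<in> J - Z \<Longrightarrow> p j \<noteq> q i"
    and independent: "\<exists>d. \<forall>j\<in>Z. \<Lambda> j \<bullet> d = c j"
begin

text \<open>In the application these coordinates hold the fractional parts of \<open>B\<close>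
  applied to a lattice point.\<close>

definition head :: "('i \<Rightarrow> real) \<Rightarrow> real ^ 'n" where
  "head x = (\<chi> i. x (q i))"

text \<open>In the application this represents modulo 1 the row \<open>\<Lambda> j\<close> applied
  to \<open>B\<close> times a lattice point. Rows in \<open>Z\<close> take integer values there,
  hence the value 0.\<close>

definition tail :: "('i \<Rightarrow> real) \<Rightarrow> 'j \<Rightarrow> real" where
  "tail x j = (if j \<in> Z then 0 else x (p j))"

text \<open>With \<open>w\<close> the integer part of \<open>B\<close> times the lattice point and
  \<open>y = w + s\<close>, this is \<open>\<Lambda> j \<bullet> y\<close> modulo 1; the integer
  \<open>z j\<close> selects the representative.\<close>

definition pull :: "int ^ 'n \<Rightarrow> ('j \<Rightarrow> int) \<Rightarrow> ('i \<Rightarrow> real) \<Rightarrow> 'j \<Rightarrow> real" where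
  "pull s z x = (\<lambda>j\<in>J. tail x j - \<Lambda> j \<bullet> (head x - vec_of_int s) - of_int (z j))"

definition pullback :: "(real ^ 'n) set \<Rightarrow> ('j \<Rightarrow> real) set \<Rightarrow> ('i \<Rightarrow> real) set" where
  "pullback W G = {x \<in> I \<rightarrow>\<^sub>E {0..<1}. \<exists>s z. head x - vec_of_int s \<in> W \<and> pull s z x \<in> G}"

lemma head_eq_sum: "head x = (\<Sum>i\<in>UNIV. x (q i) *\<^sub>R axis i 1)"
  by (simp add: head_def vec_eq_iff axis_def if_distrib cong: if_cong)

lemma continuous_map_head: "continuous_map (euclidean_fn I) euclidean head"
  unfolding head_eq_sum
proof (intro continuous_map_sum)
  fix i
  have "continuous_on UNIV (\<lambda>t. t *\<^sub>R (axis i 1 :: real ^ 'n))"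
    by (intro continuous_intros)
  then show "continuous_map (euclidean_fn I) euclidean (\<lambda>x. x (q i) *\<^sub>R (axis i 1 :: real ^ 'n))"
    using continuous_map_compose[OF continuous_map_fn_coordinate[OF q_in],
        of euclidean "\<lambda>t. t *\<^sub>R axis i 1" i]
    by (simp add: o_def)
qed simp

lemma measurable_head [measurable]: "head \<in> borel_measurable (lborel_fn I)"
proof -
  have "(\<lambda>x. x (q i)) \<in> borel_measurable (lborel_fn I)" for i
    using q_in[of i] by measurable
  then show ?thesis
    unfolding head_eq_sum by (intro borel_measurable_sum borel_measurable_scaleR) auto
qed

lemma null_frontier_head:
  assumes "frontier W \<in> null_sets lebesgue"
  shows "null_frontier I {x \<in> I \<rightarrow>\<^sub>E UNIV. head x - a \<in> W}"
proof (rule null_frontier_vimage[OF finite_I _ _ _ assms])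
  show "(\<lambda>x. head x - a) \<in> borel_measurable (lborel_fn I)" by measurable
  show "continuous_map (euclidean_fn I) euclidean (\<lambda>x. head x - a)"
    using continuous_map_compose[OF continuous_map_head, of euclidean "\<lambda>v. v - a"]
    by (simp add: o_def continuous_intros)
  \<comment> \<open>As \<open>q\<close> is injective, the entries of \<open>y\<close> can be added
    to the coordinates \<open>q i\<close> independently.\<close>
  show "head (\<lambda>k\<in>I. x k + (if k \<in> range q then y $ inv q k else 0)) - a = head x - a + y" for x y
    by (simp add: head_def vec_eq_iff q_in inj_q)
qed

lemma null_frontier_pull:
  assumes "null_frontier J G"
  shows "null_frontier I {x \<in> I \<rightarrow>\<^sub>E UNIV. pull s z x \<in> G}"
proof -
  have tail_meas: "(\<lambda>x. tail x j) \<in> borel_measurable (lborel_fn I)" if "j \<in> J" for j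
    using that p_in[of j] by (cases "j \<in> Z") (auto simp: tail_def)
  have tail_cont: "continuous_map (euclidean_fn I) euclideanreal (\<lambda>x. tail x j)" if "j \<in> J" for j
    using that p_in[of j] by (cases "j \<in> Z") (auto simp: tail_def intro: continuous_map_fn_coordinate)
  have head_cont: "continuous_map (euclidean_fn I) euclideanreal (\<lambda>x. \<Lambda> j \<bullet> (head x - vec_of_int s))"
    for j
    using continuous_map_compose[OF continuous_map_head, of euclidean "\<lambda>v. \<Lambda> j \<bullet> (v - vec_of_int s)"]
    by (simp add: o_def continuous_intros)
  \<comment> \<open>For \<open>j \<in> Z\<close> the tail is constantly 0, so the shift of the head
    alone must produce \<open>c j\<close>; the minus sign cancels the one in
    \<open>pull\<close>.\<close>
  obtain d where d: "\<Lambda> j \<bullet> d c = - c j" if "j \<in> Z" for c j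
    using independent[of "\<lambda>j. - c j" for c] by metis
  \<comment> \<open>The coordinates \<open>q i\<close> shift the head by \<open>d y\<close>. Each
    coordinate \<open>p j\<close> compensates the resulting change of
    \<open>\<Lambda> j \<bullet> head x\<close> and adds \<open>y j\<close>.\<close>
  define \<sigma> where "\<sigma> y k = (if k \<in> range q then d y $ inv q k
    else let j = inv_into (J - Z) p k in y j + \<Lambda> j \<bullet> d y)" for y k
  have head_\<sigma>: "head (\<lambda>k\<in>I. x k + \<sigma> y k) = head x + d y" for x y
    by (simp add: head_def vec_eq_iff q_in inj_q \<sigma>_def)
  have tail_\<sigma>: "tail (\<lambda>k\<in>I. x k + \<sigma> y k) j = tail x j + y j + \<Lambda> j \<bullet> d y" if "j \<in> J" for x y j
  proof (cases "j \<in> Z")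
    case True
    then show ?thesis using d[of j y] by (simp add: tail_def)
  next
    case False
    then have "p j \<notin> range q" "inv_into (J - Z) p (p j) = j" "p j \<in> I"
      using disjoint inj_p p_in that by auto
    then show ?thesis using False by (simp add: tail_def \<sigma>_def)
  qed
  show ?thesis
  proof (rule null_frontier_vimage_fn[OF finite_I finite_J _ _ _ assms])
    show "pull s z \<in> lborel_fn I \<rightarrow>\<^sub>M lborel_fn J"
      unfolding pull_def using tail_meas by (intro measurable_restrict) (auto simp: measurable_lborel1)
    show "continuous_map (euclidean_fn I) (euclidean_fn J) (pull s z)"
      unfolding continuous_map_componentwise pull_def
      using tail_cont head_cont by (auto intro!: continuous_map_diff)
    show "pull s z (\<lambda>k\<in>I. x k + \<sigma> y k) j = pull s z x j + y j" if "j \<in> J" for x y j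
      using that by (simp add: pull_def head_\<sigma> tail_\<sigma> inner_simps)
  qed
qed

text \<open>Boundedness of \<open>W\<close> and of the cubes leaves finitely many pairs of
  \<open>s\<close> and \<open>z\<close>, so the existential becomes a finite union of intersections
  of preimages under \<open>head\<close> and \<open>pull\<close>.\<close>

lemma null_frontier_pullback:
  assumes W: "jordan_measurable W" and G: "null_frontier J G" "G \<subseteq> J \<rightarrow>\<^sub>E {0..<1}"
  shows "null_frontier I (pullback W G)"
proof -
  obtain b where b: "norm w \<le> b" if "w \<in> W" for w
    using W by (auto simp: jordan_measurable_def bounded_iff)
  \<comment> \<open>The extra 1 accounts for the coordinates of the head, which lie in
    \<open>[0,1)\<close>.\<close>
  define C where "C = \<lceil>b\<rceil> + 1"
  \<comment> \<open>Up to an inner product bounded by Cauchy-Schwarz, \<open>z j\<close> is the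
    difference of \<open>tail x j\<close> and \<open>pull s z x j\<close>; these lie in
    \<open>[0,1)\<close> and cost at most 2.\<close>
  define D where "D j = \<lceil>norm (\<Lambda> j) * b\<rceil> + 2" for j
  define S where "S = {s :: int ^ 'n. \<forall>i. \<bar>s $ i\<bar> \<le> C}"
  define E where "E = (\<Pi>\<^sub>E j\<in>J. {- D j..D j})"
  let ?P = "\<lambda>s z. {x \<in> I \<rightarrow>\<^sub>E UNIV. head x - vec_of_int s \<in> W} \<inter> {x \<in> I \<rightarrow>\<^sub>E UNIV. pull s z x \<in> G}"
  have in_range: "s \<in> S \<and> restrict z J \<in> E"
    if x: "x \<in> I \<rightarrow>\<^sub>E {0..<1}" and hx: "head x - vec_of_int s \<in> W" and px: "pull s z x \<in> G" for x s z
  proof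
    have x01: "0 \<le> x k \<and> x k < 1" if "k \<in> I" for k
      using x that by (auto simp: PiE_iff)
    have "\<bar>s $ i\<bar> \<le> C" for i
    proof -
      have "\<bar>(head x - vec_of_int s) $ i\<bar> \<le> b"
        using component_le_norm_cart[of "head x - vec_of_int s" i] b[OF hx] by linarith
      then have "\<bar>x (q i) - of_int (s $ i)\<bar> \<le> b"
        by (simp add: head_def vec_of_int_def)
      then have "\<bar>of_int (s $ i) :: real\<bar> \<le> b + 1"
        using x01[OF q_in[of i]] by linarith
      then show ?thesis unfolding C_def by linarith
    qed
    then show "s \<in> S" by (simp add: S_def)
    have "\<bar>z j\<bar> \<le> D j" if j: "j \<in> J" for j
    proof -
      have "\<bar>\<Lambda> j \<bullet> (head x - vec_of_int s)\<bar> \<le> norm (\<Lambda> j) * norm (head x - vec_of_int s)"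
        by (rule Cauchy_Schwarz_ineq2)
      also have "\<dots> \<le> norm (\<Lambda> j) * b"
        by (intro mult_left_mono b hx) auto
      finally have "\<bar>\<Lambda> j \<bullet> (head x - vec_of_int s)\<bar> \<le> norm (\<Lambda> j) * b" .
      moreover have "0 \<le> tail x j \<and> tail x j < 1"
        using x01 p_in[of j] j by (auto simp: tail_def)
      moreover have "0 \<le> pull s z x j \<and> pull s z x j < 1"
        using px G(2) j by (auto simp: PiE_iff)
      ultimately have "\<bar>of_int (z j) :: real\<bar> \<le> norm (\<Lambda> j) * b + 2"
        using j by (simp add: pull_def abs_le_iff)
      then show ?thesis unfolding D_def by linarith
    qed
    then show "restrict z J \<in> E" by (auto simp: E_def abs_le_iff minus_le_iff)
  qed
  \<comment> \<open>Only the values of \<open>z\<close> on \<open>J\<close> enter, so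
    \<open>z\<close> may be taken from the finite set \<open>E\<close>.\<close>
  have pull_restrict: "pull s (restrict z J) x = pull s z x" for s z x
    by (auto simp: pull_def)
  have "pullback W G = (I \<rightarrow>\<^sub>E {0..<1}) \<inter> (\<Union>(s, z)\<in>S \<times> E. ?P s z)"
  proof (intro set_eqI iffI)
    fix x assume "x \<in> pullback W G"
    then obtain s z where x: "x \<in> I \<rightarrow>\<^sub>E {0..<1}" "head x - vec_of_int s \<in> W" "pull s z x \<in> G"
      by (auto simp: pullback_def)
    then have "(s, restrict z J) \<in> S \<times> E" "x \<in> ?P s (restrict z J)"
      using in_range by (auto simp: PiE_iff pull_restrict)
    then show "x \<in> (I \<rightarrow>\<^sub>E {0..<1}) \<inter> (\<Union>(s, z)\<in>S \<times> E. ?P s z)"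
      using x(1) by blast
  qed (auto simp: pullback_def)
  moreover have "finite (S \<times> E)"
    using finite_J by (auto simp: S_def E_def finite_bounded_int_vec intro: finite_PiE)
  moreover have "null_frontier I (?P s z)" for s z
    using W G(1) null_frontier_head null_frontier_pull
    by (intro null_frontier_Int) (auto simp: jordan_measurable_def)
  ultimately show ?thesis
    by (simp only: case_prod_beta null_frontier_Int null_frontier_UN null_frontier_unit_cube finite_I)
qed

end

section \<open>Rows of stacked powers\<close>

lemma vec_of_int_add: "vec_of_int (a + b) = vec_of_int a + vec_of_int b"
  and vec_of_int_diff: "vec_of_int (a - b) = vec_of_int a - vec_of_int b"
  by (simp_all add: vec_of_int_def vec_eq_iff)

lemma matrix_power_commute:
  fixes B :: "real ^ 'n ^ 'n"
  shows "B ** (((**) B) ^^ n) (mat 1) = (((**) B) ^^ n) (mat 1) ** B"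
  by (induction n) (simp_all, metis matrix_mul_assoc)

lemma matrix_powi_0: "matrix_powi B 0 = mat 1"
  by (simp add: matrix_powi_def)

lemma matrix_powi_1: "matrix_powi B 1 = B"
  by (simp add: matrix_powi_def)

lemma matrix_inv_left:
  "invertible (B :: real ^ 'n ^ 'n) \<Longrightarrow> matrix_inv B ** B = mat 1"
  and matrix_inv_right:
  "invertible (B :: real ^ 'n ^ 'n) \<Longrightarrow> B ** matrix_inv B = mat 1"
  by (auto simp: invertible_def matrix_inv_def intro: someI2_ex)

lemma matrix_inv_inv: "invertible (B :: real ^ 'n ^ 'n) \<Longrightarrow> matrix_inv (matrix_inv B) = B"
  by (metis invertible_def matrix_inv_left matrix_inv_right matrix_mul_assoc matrix_mul_lid matrix_mul_rid)

lemma invertible_matrix_inv: "invertible (B :: real ^ 'n ^ 'n) \<Longrightarrow> invertible (matrix_inv B)"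
  using invertible_def matrix_inv_left matrix_inv_right by blast

text \<open>Powers are built by multiplication on the left, whereas substituting
  \<open>B *v v\<close> into a row multiplies on the right. A matrix commutes with its powers, and
  for negative exponents one inverse factor cancels.\<close>

lemma matrix_powi_plus_1:
  fixes B :: "real ^ 'n ^ 'n"
  assumes "invertible B"
  shows "matrix_powi B (k + 1) = matrix_powi B k ** B"
proof (cases "k \<ge> 0")
  case True
  then show ?thesis
    by (simp add: matrix_powi_def nat_add_distrib matrix_power_commute)
next
  case False
  define m where "m = nat (- k - 1)"
  have m: "nat (- k) = Suc m" "k + 1 = - int m"
    using False by (auto simp: m_def)
  let ?P = "(((**) (matrix_inv B)) ^^ m) (mat 1)"
  have "matrix_powi B k ** B = (matrix_inv B ** ?P) ** B"
    using False by (simp add: matrix_powi_def m)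
  also have "\<dots> = ?P ** (matrix_inv B ** B)"
    by (simp add: matrix_power_commute matrix_mul_assoc)
  also have "\<dots> = ?P"
    by (simp add: matrix_inv_left assms)
  \<comment> \<open>For \<open>m = 0\<close> the exponent falls into the nonnegative branch of the
    definition; both sides are then the identity.\<close>
  also have "\<dots> = matrix_powi B (k + 1)"
    unfolding m(2) by (simp add: matrix_powi_def)
  finally show ?thesis by simp
qed

lemma matrix_powi_inv:
  assumes "invertible (B :: real ^ 'n ^ 'n)"
  shows "matrix_powi (matrix_inv B) k = matrix_powi B (- k)"
  by (auto simp: matrix_powi_def matrix_inv_inv[OF assms])

text \<open>Exponent 0 is outside the stacks but arises when -1 is raised by one. Its rows are
  integer on lattice points, which is why such rows are put into \<open>Z\<close>.\<close>

lemma stacked_powers_0: "stacked_powers B (0, i) \<bullet> v = v $ i"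
  using matrix_vector_mul_component[of "mat 1" v i]
  by (simp add: stacked_powers_def matrix_powi_0 row_def)

lemma stacked_powers_1: "stacked_powers B (1, i) \<bullet> v = (B *v v) $ i"
  using matrix_vector_mul_component[of B v i]
  by (simp add: stacked_powers_def matrix_powi_1 row_def)

lemma stacked_powers_plus_1:
  assumes "invertible B"
  shows "stacked_powers B (k + 1, i) \<bullet> v = stacked_powers B (k, i) \<bullet> (B *v v)"
  using matrix_vector_mul_component[of "matrix_powi B k" "B *v v" i]
    matrix_vector_mul_component[of "matrix_powi B (k + 1)" v i]
  by (simp add: stacked_powers_def row_def matrix_powi_plus_1[OF assms] matrix_vector_mul_assoc)

lemma quasi_algebra_reindex:
  assumes "inj_on \<phi> J"
  shows "quasi_algebra J (\<lambda>j. M (\<phi> j)) \<subseteq> quasi_algebra (\<phi> ` J) M"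
proof
  fix A assume "A \<in> quasi_algebra J (\<lambda>j. M (\<phi> j))"
  then obtain m r where m: "m \<ge> 1" "inj_on r {..<m}" "r ` {..<m} \<subseteq> J"
    "A \<in> quasi_class m (\<lambda>i. M ((\<phi> \<circ> r) i))"
    by (auto simp: quasi_algebra_def)
  have "inj_on (\<phi> \<circ> r) {..<m}" "(\<phi> \<circ> r) ` {..<m} \<subseteq> \<phi> ` J"
    using m assms by (auto intro: comp_inj_on inj_on_subset)
  then show "A \<in> quasi_algebra (\<phi> ` J) M"
    using m(1,4) unfolding quasi_algebra_def by blast
qed

lemma jordan_measurable_fn_iff:
  assumes "G \<subseteq> {..<m} \<rightarrow>\<^sub>E {0..<1}"
  shows "jordan_measurable_fn m G \<longleftrightarrow> null_frontier {..<m} G"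
proof -
  have "G \<subseteq> {..<m} \<rightarrow>\<^sub>E UNIV" using assms by (auto simp: PiE_iff)
  moreover have "\<bar>g i\<bar> \<le> 1" if "g \<in> G" "i < m" for g i
  proof -
    have "g i \<in> {0..<1}" using assms that by (auto simp: PiE_iff)
    then show ?thesis by simp
  qed
  then have "\<exists>B. \<forall>g\<in>G. \<forall>i<m. \<bar>g i\<bar> \<le> B" by blast
  ultimately show ?thesis by (simp add: jordan_measurable_fn_def null_frontier_def)
qed

section \<open>Pullbacks of lattice sets as quasi-sets\<close>

definition lattice_pullback ::
    "real ^ 'n ^ 'n \<Rightarrow> (real ^ 'n) set \<Rightarrow> (int ^ 'n) set \<Rightarrow> (int ^ 'n) set" where
  "lattice_pullback B W A = {x. \<exists>y\<in>A. B *v vec_of_int x - vec_of_int y \<in> W}"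

text \<open>Exponent 1 must lie in \<open>J'\<close> because the rows of \<open>B\<close> locate the
  point \<open>y\<close>. Exponent -1 is exempt from the shift, since it leads to integer values.
  Excluding 0 from \<open>J\<close> keeps the shifted rows apart from the added rows of exponent
  1.\<close>

lemma lattice_pullback_in_quasi_algebra:
  fixes B :: "real ^ 'n ^ 'n"
  assumes B: "invertible B" and W: "jordan_measurable W"
    and A: "A \<in> quasi_algebra (J \<times> UNIV) (stacked_powers B)"
    and J: "0 \<notin> J" "1 \<in> J'" "\<And>k. k \<in> J \<Longrightarrow> k \<noteq> -1 \<Longrightarrow> k + 1 \<in> J'"
  shows "lattice_pullback B W A \<in> quasi_algebra (J' \<times> UNIV) (stacked_powers B)"
proof -
  obtain m r G where r: "inj_on r {..<m}" "r ` {..<m} \<subseteq> J \<times> UNIV"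
    and G: "G \<subseteq> {..<m} \<rightarrow>\<^sub>E {0..<1}" "jordan_measurable_fn m G"
    and A_eq: "A = quasi_set m G (\<lambda>j. stacked_powers B (r j))"
    using A unfolding quasi_algebra_def quasi_class_def by blast
  define \<Lambda> where "\<Lambda> j = stacked_powers B (r j)" for j
  define Z where "Z = {j \<in> {..<m}. fst (r j) = -1}"
  define shift where "shift j = (fst (r j) + 1, snd (r j))" for j
  \<comment> \<open>\<open>F\<close> holds the row indices of the new matrix and \<open>e\<close>
    numbers them; \<open>p\<close> and \<open>q\<close> return the numbers of the shifted rows and
    of the rows of \<open>B\<close>.\<close>
  define F where "F = shift ` ({..<m} - Z) \<union> {1} \<times> UNIV"
  define M where "M = card F"
  have fin_F: "finite F" unfolding F_def by auto
  have M_pos: "M \<ge> 1"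
    unfolding M_def using fin_F by (simp add: F_def Suc_le_eq card_gt_0_iff)
  obtain e where e: "bij_betw e {..<M} F"
    using ex_bij_betw_nat_finite[OF fin_F] unfolding M_def by (auto simp: atLeast0LessThan)
  define f where "f = inv_into {..<M} e"
  have f: "f a < M" "e (f a) = a" if "a \<in> F" for a
    using that e by (auto simp: f_def bij_betw_def inv_into_into f_inv_into_f
        dest: inv_into_into[of a e "{..<M}"])
  define p where "p j = f (shift j)" for j
  define q :: "'n \<Rightarrow> nat" where "q i = f (1, i)" for i
  have p: "p j < M" "e (p j) = shift j" if "j \<in> {..<m} - Z" for j
    using f[of "shift j"] that by (auto simp: p_def F_def)
  have q: "q i < M" "e (q i) = (1, i)" for i
    using f[of "(1, i)"] by (auto simp: q_def F_def)
  have r_nonzero: "fst (r j) \<noteq> 0" if "j < m" for j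
    using that r(2) J(1) by (metis imageI lessThan_iff mem_Times_iff subsetD)
  have \<Lambda>_shift: "\<Lambda> j \<bullet> (B *v v) = stacked_powers B (shift j) \<bullet> v" for j v
    using stacked_powers_plus_1[OF B, of "fst (r j)" "snd (r j)" v]
    by (simp add: \<Lambda>_def shift_def)
  have \<Lambda>_Z: "\<Lambda> j \<bullet> (B *v v) = v $ snd (r j)" if "j \<in> Z" for j v
    using that by (simp add: \<Lambda>_shift) (simp add: Z_def shift_def stacked_powers_0)
  interpret torus_pullback "{..<M}" "{..<m}" Z p q \<Lambda>
  proof
    show "inj_on p ({..<m} - Z)"
    proof (rule inj_onI)
      fix i j assume ij: "i \<in> {..<m} - Z" "j \<in> {..<m} - Z" "p i = p j"
      then have "shift i = shift j" using p(2) by metis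
      then have "r i = r j" by (simp add: shift_def prod_eq_iff)
      then show "i = j" using ij r(1) by (auto simp: inj_on_def)
    qed
    show "inj q"
      by (rule injI) (metis q(2) prod.inject)
    show "p j \<noteq> q i" if "j \<in> {..<m} - Z" for i j
    proof
      assume "p j = q i"
      then have "shift j = (1, i)" using p(2)[OF that] q(2) by metis
      then show False using r_nonzero[of j] that by (simp add: shift_def)
    qed
    \<comment> \<open>The rows in \<open>Z\<close> are rows of the inverse of \<open>B\<close>,
      pairwise distinct because \<open>r\<close> is injective. On \<open>B *v v\<close> they read
      off distinct coordinates of \<open>v\<close>, which can be prescribed.\<close>
    show "\<exists>d. \<forall>j\<in>Z. \<Lambda> j \<bullet> d = c j" for c
    proof (intro exI ballI)
      fix j assume j: "j \<in> Z"
      have "r j = (-1, snd (r j))" using j by (simp add: Z_def prod_eq_iff)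
      then have "inv_into {..<m} r (-1, snd (r j)) = j"
        using j r(1) by (metis (lifting) Z_def inv_into_f_f mem_Collect_eq)
      then show "\<Lambda> j \<bullet> (B *v (\<chi> i. c (inv_into {..<m} r (-1, i)))) = c j"
        by (simp add: \<Lambda>_Z[OF j])
    qed
  qed (use p q in \<open>auto simp: Z_def\<close>)
  \<comment> \<open>The new rows at \<open>x\<close> are split into torus coordinates
    \<open>g\<close> and integers \<open>z\<close>. Accordingly \<open>w\<close> is the integer part
    of \<open>B *v vec_of_int x\<close>, and \<open>c\<close> that of the old rows applied to it; on
    \<open>Z\<close> the whole value is an integer coordinate of \<open>x\<close>.\<close>
  have pull_eq: "head g = B *v vec_of_int x - vec_of_int w
      \<and> pull s z' g = (\<lambda>j\<in>{..<m}. \<Lambda> j \<bullet> vec_of_int (w + s) - of_int (c j + z' j))"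
    if g: "\<And>k. k < M \<Longrightarrow> stacked_powers B (e k) \<bullet> vec_of_int x = g k + of_int (z k)"
      and w: "w = (\<chi> i. z (q i))" and c: "c = (\<lambda>j. if j \<in> Z then x $ snd (r j) else z (p j))"
    for g x z w c s z'
  proof
    have "(B *v vec_of_int x) $ i = g (q i) + of_int (z (q i))" for i
      using g[OF q(1), of i] by (simp add: q(2) stacked_powers_1)
    then show head_g: "head g = B *v vec_of_int x - vec_of_int w"
      by (simp add: head_def vec_eq_iff w vec_of_int_def)
    have "\<Lambda> j \<bullet> (B *v vec_of_int x) = tail g j + of_int (c j)" if "j < m" for j
    proof (cases "j \<in> Z")
      case True
      then show ?thesis by (simp add: \<Lambda>_Z tail_def c vec_of_int_def)
    next
      case False
      then show ?thesis
        using that g[of "p j"] p[of j] by (simp add: \<Lambda>_shift tail_def c)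
    qed
    then show "pull s z' g = (\<lambda>j\<in>{..<m}. \<Lambda> j \<bullet> vec_of_int (w + s) - of_int (c j + z' j))"
      unfolding pull_def head_g
      by (intro restrict_ext) (simp add: inner_simps vec_of_int_add)
  qed
  have "lattice_pullback B W A = quasi_set M (pullback W G) (\<lambda>k. stacked_powers B (e k))"
  proof (intro set_eqI iffI)
    fix x assume "x \<in> lattice_pullback B W A"
    then obtain y h u where y: "B *v vec_of_int x - vec_of_int y \<in> W" and h: "h \<in> G"
      and u: "\<And>j. j < m \<Longrightarrow> \<Lambda> j \<bullet> vec_of_int y = h j + of_int (u j)"
      by (auto simp: lattice_pullback_def A_eq quasi_set_def \<Lambda>_def)
    define z where "z k = \<lfloor>stacked_powers B (e k) \<bullet> vec_of_int x\<rfloor>" for k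
    define g where "g = (\<lambda>k\<in>{..<M}. frac (stacked_powers B (e k) \<bullet> vec_of_int x))"
    define w where "w = (\<chi> i. z (q i))"
    define c where "c = (\<lambda>j. if j \<in> Z then x $ snd (r j) else z (p j))"
    have g: "stacked_powers B (e k) \<bullet> vec_of_int x = g k + of_int (z k)" if "k < M" for k
      using that by (simp add: g_def z_def frac_def)
    \<comment> \<open>The offsets \<open>y - w\<close> and \<open>u j - c j\<close> make
      \<open>pull\<close> return exactly the given \<open>h\<close>.\<close>
    have eqs: "head g = B *v vec_of_int x - vec_of_int w"
        "pull (y - w) (\<lambda>j. u j - c j) g = (\<lambda>j\<in>{..<m}. \<Lambda> j \<bullet> vec_of_int y - of_int (u j))"
      using pull_eq[OF g w_def c_def, of "y - w" "\<lambda>j. u j - c j"] by simp_all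
    have "pull (y - w) (\<lambda>j. u j - c j) g = h"
    proof (rule extensionalityI[of _ "{..<m}"])
      show "h \<in> extensional {..<m}" using h G(1) by (auto simp: PiE_iff)
    qed (simp_all add: eqs u)
    moreover have "head g - vec_of_int (y - w) \<in> W"
      using eqs y by (simp add: vec_of_int_diff)
    moreover have "g \<in> {..<M} \<rightarrow>\<^sub>E {0..<1}"
      by (simp add: g_def frac_lt_1)
    ultimately have "g \<in> pullback W G"
      using h unfolding pullback_def by blast
    then show "x \<in> quasi_set M (pullback W G) (\<lambda>k. stacked_powers B (e k))"
      using g unfolding quasi_set_def by blast
  next
    fix x assume "x \<in> quasi_set M (pullback W G) (\<lambda>k. stacked_powers B (e k))"
    then obtain g z where "g \<in> pullback W G"
      and g: "\<And>k. k < M \<Longrightarrow> stacked_powers B (e k) \<bullet> vec_of_int x = g k + of_int (z k)"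
      unfolding quasi_set_def by blast
    then obtain s z' where s: "head g - vec_of_int s \<in> W" "pull s z' g \<in> G"
      unfolding pullback_def by blast
    define w where "w = (\<chi> i. z (q i))"
    define c where "c = (\<lambda>j. if j \<in> Z then x $ snd (r j) else z (p j))"
    note eqs = pull_eq[OF g w_def c_def, of s z']
    \<comment> \<open>Conversely, the witness in \<open>A\<close> is \<open>w + s\<close>.\<close>
    have "\<Lambda> j \<bullet> vec_of_int (w + s) = pull s z' g j + of_int (c j + z' j)" if "j < m" for j
      using eqs that by simp
    then have "\<exists>u. \<forall>j<m. \<Lambda> j \<bullet> vec_of_int (w + s) = pull s z' g j + of_int (u j)"
      by (intro exI[of _ "\<lambda>j. c j + z' j"]) simp
    then have "w + s \<in> A"
      using s(2) unfolding A_eq quasi_set_def \<Lambda>_def by blast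
    moreover have "B *v vec_of_int x - vec_of_int (w + s) \<in> W"
      using eqs s(1) by (simp add: vec_of_int_add diff_diff_eq)
    ultimately show "x \<in> lattice_pullback B W A"
      unfolding lattice_pullback_def by blast
  qed
  moreover have "pullback W G \<subseteq> {..<M} \<rightarrow>\<^sub>E {0..<1}"
    by (auto simp: pullback_def)
  moreover from this have "jordan_measurable_fn M (pullback W G)"
    using null_frontier_pullback[OF W _ G(1)] G by (simp add: jordan_measurable_fn_iff)
  ultimately have "lattice_pullback B W A \<in> quasi_class M (\<lambda>k. stacked_powers B (e k))"
    unfolding quasi_class_def by blast
  moreover have "inj_on e {..<M}" "e ` {..<M} \<subseteq> J' \<times> UNIV"
  proof -
    have "shift j \<in> J' \<times> UNIV" if "j < m" "j \<notin> Z" for j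
      using that r(2) J(3)[of "fst (r j)"] by (force simp: shift_def Z_def)
    then have "F \<subseteq> J' \<times> UNIV"
      unfolding F_def using J(2) by (intro Un_least image_subsetI) auto
    then show "inj_on e {..<M}" "e ` {..<M} \<subseteq> J' \<times> UNIV"
      using e by (auto simp: bij_betw_def)
  qed
  ultimately show ?thesis
    using M_pos unfolding quasi_algebra_def by blast
qed

section \<open>Invariance and iteration of pullbacks\<close>

lemma lattice_pullback_associated:
  assumes "invertible B" "jordan_measurable W" "A \<in> associated_algebra B"
  shows "lattice_pullback B W A \<in> associated_algebra B"
  using assms unfolding associated_algebra_def
  by (rule lattice_pullback_in_quasi_algebra) auto

lemma lattice_pullback_forward:
  assumes "invertible B" "jordan_measurable W" "A \<in> forward_algebra B"
  shows "lattice_pullback B W A \<in> forward_algebra B"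
  using assms unfolding forward_algebra_def
  by (rule lattice_pullback_in_quasi_algebra) auto

lemma lattice_pullback_iterate_forward:
  assumes B: "invertible B" and W: "jordan_measurable W" and A: "A \<in> associated_algebra B"
  obtains N where "\<And>k. k \<ge> N \<Longrightarrow> (lattice_pullback B W ^^ k) A \<in> forward_algebra B"
proof -
  \<comment> \<open>Each pullback adds exponent 1, so all positive exponents are allowed from the
    start; only the lower bound \<open>l\<close> on the negative ones moves up, by one per
    step.\<close>
  define J :: "int \<Rightarrow> int set" where "J l = {k. k \<noteq> 0 \<and> (k > 0 \<or> k \<ge> l)}" for l
  obtain m r where r: "m \<ge> 1" "inj_on r {..<m}" "r ` {..<m} \<subseteq> {k. k \<noteq> 0} \<times> UNIV"
    and A': "A \<in> quasi_class m (\<lambda>j. stacked_powers B (r j))"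
    using A unfolding associated_algebra_def quasi_algebra_def by blast
  define l where "l = Min ((\<lambda>j. fst (r j)) ` {..<m})"
  have "l \<le> fst (r j)" if "j < m" for j
    using that by (auto simp: l_def)
  then have "r ` {..<m} \<subseteq> J l \<times> UNIV"
    using r(3) by (force simp: J_def)
  then have A_l: "A \<in> quasi_algebra (J l \<times> UNIV) (stacked_powers B)"
    using r A' unfolding quasi_algebra_def by blast
  have iter: "(lattice_pullback B W ^^ k) A \<in> quasi_algebra (J (l + int k) \<times> UNIV) (stacked_powers B)"
    for k
  proof (induction k)
    case (Suc k)
    then have "lattice_pullback B W ((lattice_pullback B W ^^ k) A)
        \<in> quasi_algebra (J (l + int (Suc k)) \<times> UNIV) (stacked_powers B)"
      by (rule lattice_pullback_in_quasi_algebra[OF B W]) (auto simp: J_def)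
    then show ?case by simp
  qed (use A_l in simp)
  show ?thesis
  proof
    \<comment> \<open>From here on the lower bound is at least 0, and exponent 0 is excluded, so
      only positive exponents remain.\<close>
    fix k assume "k \<ge> nat (- l)"
    then have "J (l + int k) = {k. k > 0}" by (auto simp: J_def)
    then show "(lattice_pullback B W ^^ k) A \<in> forward_algebra B"
      using iter[of k] by (simp add: forward_algebra_def)
  qed
qed

section \<open>Inversion of the matrix and reflection of the exponents\<close>

lemma quasi_algebra_matrix_inv_subset:
  assumes "invertible (B :: real ^ 'n ^ 'n)"
  shows "quasi_algebra (J \<times> UNIV) (stacked_powers (matrix_inv B))
    \<subseteq> quasi_algebra (uminus ` J \<times> UNIV) (stacked_powers B)"
proof -
  let ?\<phi> = "map_prod uminus id :: int \<times> 'n \<Rightarrow> int \<times> 'n"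
  have "stacked_powers (matrix_inv B) = (\<lambda>j. stacked_powers B (?\<phi> j))"
    by (auto simp: stacked_powers_def matrix_powi_inv[OF assms])
  moreover have "inj_on ?\<phi> (J \<times> UNIV)"
    by (auto simp: inj_on_def)
  moreover have "?\<phi> ` (J \<times> UNIV) = uminus ` J \<times> UNIV"
    by (rule map_prod_surj_on) auto
  ultimately show ?thesis
    by (metis quasi_algebra_reindex)
qed

text \<open>The reverse inclusion is the same inclusion for the inverse matrix and the negated
  exponents.\<close>

lemma quasi_algebra_matrix_inv:
  assumes B: "invertible (B :: real ^ 'n ^ 'n)"
  shows "quasi_algebra (J \<times> UNIV) (stacked_powers (matrix_inv B))
    = quasi_algebra (uminus ` J \<times> UNIV) (stacked_powers B)"
  using quasi_algebra_matrix_inv_subset[OF B, of J]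
    quasi_algebra_matrix_inv_subset[OF invertible_matrix_inv[OF B], of "uminus ` J"]
  by (simp add: matrix_inv_inv[OF B] image_image)

lemma uminus_image_int:
  "uminus ` {k :: int. k \<noteq> 0} = {k. k \<noteq> 0}" "uminus ` {k :: int. k > 0} = {k. k < 0}"
  by (auto intro: image_eqI[of k uminus "- k" for k])

lemma associated_algebra_matrix_inv:
  "invertible B \<Longrightarrow> associated_algebra (matrix_inv B) = associated_algebra B"
  by (simp add: associated_algebra_def quasi_algebra_matrix_inv uminus_image_int)

lemma forward_algebra_matrix_inv:
  "invertible B \<Longrightarrow> forward_algebra (matrix_inv B) = backward_algebra B"
  by (simp add: forward_algebra_def backward_algebra_def quasi_algebra_matrix_inv uminus_image_int)

section \<open>The transition operator in terms of pullbacks\<close>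

text \<open>An injective linear self-map commutes with closure and interior and sends null sets to
  null sets. It is applied to \<open>V\<close> to obtain \<open>W\<close>.\<close>

lemma jordan_measurable_linear_image:
  fixes h :: "'a :: euclidean_space \<Rightarrow> 'a"
  assumes "linear h" "inj h" "jordan_measurable S"
  shows "jordan_measurable (h ` S)"
proof -
  have "frontier (h ` S) = h ` frontier S"
    unfolding frontier_def
    using assms(1,2) by (simp add: closure_injective_linear_image interior_injective_linear_image
        image_set_diff)
  moreover have "negligible (h ` frontier S)"
    using assms by (intro negligible_differentiable_image_negligible linear_imp_differentiable_on)
      (simp_all add: jordan_measurable_def negligible_iff_null_sets)
  ultimately show ?thesis
    using assms by (simp add: jordan_measurable_def bounded_linear_image
        linear_conv_bounded_linear negligible_iff_null_sets)
qed

lemma vimage_transition: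
  assumes "quantizer R"
  shows "transition R L -` A = lattice_pullback L {u. R u = 0} A"
proof -
  \<comment> \<open>The translation law carries the cell of any lattice point \<open>y\<close> onto
    the cell of 0.\<close>
  have "R (u - vec_of_int y) = 0 \<longleftrightarrow> R u = y" for u y
    using assms[unfolded quantizer_def, THEN conjunct1, rule_format, of "u - vec_of_int y" y]
    by simp
  then show ?thesis by (auto simp: lattice_pullback_def transition_def)
qed

lemma image_transition:
  assumes "quantizer R" and L: "invertible L"
  shows "transition R L ` A
    = lattice_pullback (matrix_inv L) ((\<lambda>u. - (matrix_inv L *v u)) ` {u. R u = 0}) A"
proof -
  have inv: "matrix_inv L *v (L *v u) = u" "L *v (matrix_inv L *v u) = u" for u
    by (simp_all add: matrix_vector_mul_assoc matrix_inv_left matrix_inv_right L)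
  have "matrix_inv L *v vec_of_int y - vec_of_int x \<in> (\<lambda>u. - (matrix_inv L *v u)) ` {u. R u = 0}
      \<longleftrightarrow> R (L *v vec_of_int x - vec_of_int y) = 0" for x y
  proof -
    have "matrix_inv L *v vec_of_int y - vec_of_int x = - (matrix_inv L *v u)
        \<longleftrightarrow> u = L *v vec_of_int x - vec_of_int y" for u
      by (metis (no_types, lifting) inv matrix_vector_mult_diff_distrib minus_diff_eq
          minus_equation_iff)
    then show ?thesis by (simp only: image_iff mem_Collect_eq bex_simps) blast
  qed
  moreover have "y \<in> transition R L ` A \<longleftrightarrow>
      (\<exists>x\<in>A. R (L *v vec_of_int x - vec_of_int y) = 0)" for y
  proof -
    \<comment> \<open>Writing the image through preimages of singletons reuses the description of
      the preimage.\<close>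
    have "y \<in> transition R L ` A \<longleftrightarrow> (\<exists>x\<in>A. x \<in> transition R L -` {y})" by auto
    then show ?thesis
      by (simp only: vimage_transition[OF assms(1)]) (simp add: lattice_pullback_def)
  qed
  ultimately show ?thesis
    by (intro set_eqI) (simp only: lattice_pullback_def mem_Collect_eq)
qed

lemma vimage_funpow:
  fixes T :: "'a \<Rightarrow> 'a"
  shows "(T ^^ k) -` A = ((-`) T ^^ k) A"
proof (induction k)
  case (Suc k)
  have "(T ^^ Suc k) -` A = T -` ((T ^^ k) -` A)"
    by (simp only: funpow_Suc_right vimage_comp)
  then show ?case by (simp only: Suc funpow.simps(2)[where f = "(-`) T"] o_apply)
qed simp

lemma image_funpow:
  fixes T :: "'a \<Rightarrow> 'a"
  shows "(T ^^ k) ` A = ((`) T ^^ k) A"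
proof (induction k)
  case (Suc k)
  have "(T ^^ Suc k) ` A = T ` ((T ^^ k) ` A)"
    by (simp add: image_comp)
  then show ?case by (simp add: Suc)
qed simp

theorem theorem6:
  fixes R :: "real ^ 'n \<Rightarrow> int ^ 'n" and L :: "real ^ 'n ^ 'n" and T :: "int ^ 'n \<Rightarrow> int ^ 'n"
  assumes "quantizer R" and "invertible L" and "T = transition R L"
  shows "((\<lambda>A. T -` A) ` associated_algebra L \<subseteq> associated_algebra L
          \<and> (\<lambda>A. T ` A) ` associated_algebra L \<subseteq> associated_algebra L)
       \<and> (\<lambda>A. T -` A) ` forward_algebra L \<subseteq> forward_algebra L
       \<and> (\<lambda>A. T ` A) ` backward_algebra L \<subseteq> backward_algebra L
       \<and> (\<forall>A \<in> associated_algebra L. \<exists>N\<ge>1. \<forall>k\<ge>N.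
            (T ^^ k) -` A \<in> forward_algebra L \<and> (T ^^ k) ` A \<in> backward_algebra L)"
proof -
  define V where "V = {u. R u = 0}"
  define W where "W = (\<lambda>u. - (matrix_inv L *v u)) ` V"
  \<comment> \<open>Statements about images under \<open>T\<close> become statements about preimages
    for \<open>L'\<close>, whose forward algebra is the backward algebra of
    \<open>L\<close>.\<close>
  define L' where "L' = matrix_inv L"
  have L': "invertible L'" "associated_algebra L' = associated_algebra L"
    "forward_algebra L' = backward_algebra L"
    using assms(2) by (simp_all add: L'_def invertible_matrix_inv associated_algebra_matrix_inv
        forward_algebra_matrix_inv)
  have V: "jordan_measurable V"
    using assms(1) by (simp add: quantizer_def V_def)
  have "linear (\<lambda>u. - (matrix_inv L *v u))"
    by (intro linear_compose_neg matrix_vector_mul_linear)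
  moreover have "inj (\<lambda>u. - (matrix_inv L *v u))"
    using assms(2) by (intro injI)
      (metis matrix_inv_right matrix_vector_mul_assoc matrix_vector_mul_lid neg_equal_iff_equal)
  ultimately have W: "jordan_measurable W"
    unfolding W_def using V by (rule jordan_measurable_linear_image)
  have T: "(-`) T = lattice_pullback L V" "(`) T = lattice_pullback L' W"
    using assms(1,2) by (simp_all add: fun_eq_iff assms(3) V_def W_def L'_def vimage_transition image_transition)
  have "\<exists>N\<ge>1. \<forall>k\<ge>N. (T ^^ k) -` A \<in> forward_algebra L \<and> (T ^^ k) ` A \<in> backward_algebra L"
    if A: "A \<in> associated_algebra L" for A
  proof -
    obtain N1 where N1: "\<And>k. k \<ge> N1 \<Longrightarrow> (lattice_pullback L V ^^ k) A \<in> forward_algebra L"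
      using lattice_pullback_iterate_forward[OF assms(2) V A] by blast
    obtain N2 where N2: "\<And>k. k \<ge> N2 \<Longrightarrow> (lattice_pullback L' W ^^ k) A \<in> backward_algebra L"
      using lattice_pullback_iterate_forward[OF L'(1) W] A L'(2,3) by metis
    \<comment> \<open>The 1 in the maximum makes the threshold a positive integer.\<close>
    have "\<forall>k \<ge> max 1 (max N1 N2).
        (T ^^ k) -` A \<in> forward_algebra L \<and> (T ^^ k) ` A \<in> backward_algebra L"
      using N1 N2 by (simp add: vimage_funpow image_funpow T)
    then show ?thesis by (meson max.cobounded1)
  qed
  then show ?thesis
    using lattice_pullback_associated[OF assms(2) V] lattice_pullback_forward[OF assms(2) V]
      lattice_pullback_associated[OF L'(1) W] lattice_pullback_forward[OF L'(1) W]
    unfolding T L' by blast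
qed

end
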